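(* Fix an integer $d\ge 1$. Let $\lambda$ be a partition of $n$ with $\ell(\lambda)\le d$ (set $\lambda_i=0$ for $i>\ell(\lambda)$). Then, as an identity of rational functions in the indeterminate $\beta$, $$\sum_{T\in\operatorname{SIT}(\lambda)}\ \prod_{k=1}^{m(T)}\left(\left[\prod_{i=1}^d \frac{1+\beta\big(\nu_i(T_{<k})+d-i+1\big)}{1+\beta\big(\lambda_i+d-i+1\big)}\right]-1\right)^{-1} \;=\; \frac{1}{(-\beta)^{n}}\prod_{i=1}^{\ell(\lambda)}\big(1+\beta(\lambda_i+d-i+1)\big)^{\lambda_i}\prod_{(i,j)\in\lambda}\frac{1}{h(i,j)}.$$
   Context: Partitions are identified with Young diagrams $\{(i,j): 1\le j\le \lambda_i\}$ (English convention, $i$ = row, $j$ = column); $\lambda'$ is the conjugate partition and $h(i,j)=\lambda_i-j+\lambda'_j-i+1$ is the hook length. A standard increasing tableau of shape $\lambda$ is a filling $T$ of the cells of $\lambda$ by positive integers, strictly increasing left to right along rows and top to bottom down columns, whose set of entries is exactly $\{1,\dots,m\}$ for some $m$; this $m$ is denoted $m(T)$, and $\operatorname{SIT}(\lambda)$ is the set of such tableaux. For $k\ge1$, $T_{<k}$ denotes the set of cells with entry strictly less than $k$; it is a Young diagram of a partition denoted $\nu(T_{<k})$, with parts $\nu_i(T_{<k})$ ($=0$ for $i$ beyond its length). *)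

theory Defs
  imports "HOL-Computational_Algebra.Polynomial" "HOL-Computational_Algebra.Fraction_Field"
begin

definition is_partition :: "nat list \<Rightarrow> bool" where
  "is_partition lam \<longleftrightarrow> sorted_wrt (\<ge>) lam \<and> (\<forall>x\<in>set lam. 0 < x)"

definition part :: "nat list \<Rightarrow> nat \<Rightarrow> nat" where
  "part lam i = (if 1 \<le> i \<and> i \<le> length lam then lam ! (i - 1) else 0)"

definition cells :: "nat list \<Rightarrow> (nat \<times> nat) set" where
  "cells lam = {(i, j). 1 \<le> i \<and> i \<le> length lam \<and> 1 \<le> j \<and> j \<le> part lam i}"

definition conj_part :: "nat list \<Rightarrow> nat \<Rightarrow> nat" where
  "conj_part lam j = card {i. (i, j) \<in> cells lam}"

definition hook :: "nat list \<Rightarrow> nat \<Rightarrow> nat \<Rightarrow> nat" where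
  "hook lam i j = (part lam i - j) + (conj_part lam j - i) + 1"

definition SIT :: "nat list \<Rightarrow> (nat \<times> nat \<Rightarrow> nat) set" where
  "SIT lam = {T. (\<forall>c. c \<notin> cells lam \<longrightarrow> T c = 0)
     \<and> (\<forall>i j j'. (i, j) \<in> cells lam \<longrightarrow> (i, j') \<in> cells lam \<longrightarrow> j < j' \<longrightarrow> T (i, j) < T (i, j'))
     \<and> (\<forall>i i' j. (i, j) \<in> cells lam \<longrightarrow> (i', j) \<in> cells lam \<longrightarrow> i < i' \<longrightarrow> T (i, j) < T (i', j))
     \<and> (\<exists>m. T ` cells lam = {1..m})}"

text \<open>m(T): the largest entry, i.e. the m with entry set {1..m}.\<close>
definition mT :: "nat list \<Rightarrow> (nat \<times> nat \<Rightarrow> nat) \<Rightarrow> nat" where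
  "mT lam T = card (T ` cells lam)"

definition nu :: "nat list \<Rightarrow> (nat \<times> nat \<Rightarrow> nat) \<Rightarrow> nat \<Rightarrow> nat \<Rightarrow> nat" where
  "nu lam T k i = card {j. (i, j) \<in> cells lam \<and> T (i, j) < k}"

definition beta :: "rat poly fract" where
  "beta = Fract [:0, 1:] 1"

end

theory Submission
  imports Defs "Jordan_Normal_Form.Determinant"
begin

text \<open>
  Write \<open>l\<^sub>i = \<lambda>\<^sub>i + d - i\<close>, \<open>u\<^sub>i = 1 + \<beta> (l\<^sub>i + 1)\<close>, and let \<open>D \<mu>\<close> be the determinant of the matrix with entries
  \<open>(l\<^sub>j)\<^sub>k (-\<beta>)^k u\<^sub>j^(-\<mu>\<^sub>i)\<close>, where \<open>k = \<mu>\<^sub>i + d - i\<close> and \<open>(x)\<^sub>k\<close> is a falling factorial; up to a Vandermonde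
  factor this is a factorial Grothendieck polynomial of \<open>\<mu>\<close> evaluated at a point attached to \<open>\<lambda>\<close>.
  Raising \<open>\<mu>\<^sub>i\<close> by one in row \<open>i\<close> and adding the result to that row multiplies entry \<open>j\<close> by
  \<open>(1 + \<beta> (\<mu>\<^sub>i + d - i + 1)) / u\<^sub>j\<close>. Multilinearity then gives a Chevalley rule: \<open>D \<mu>\<close> times the product
  in the theorem equals the sum of \<open>D \<nu>\<close> over all \<open>\<nu>\<close> such that \<open>\<nu>/\<mu>\<close> has no two cells in a row or
  column, and \<open>D \<nu> = 0\<close> unless \<open>\<nu> \<subseteq> \<lambda>\<close>. Removing the cells with entry 1 from a skew increasing
  tableau gives the same recursion, so the weighted sum over tableaux of shape \<open>\<lambda>/\<mu>\<close> is \<open>D \<mu> / D \<lambda>\<close>.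
  For \<open>\<mu> = \<emptyset>\<close> the numerator is a Vandermonde determinant, and \<open>D \<lambda>\<close> is triangular with
  factorials on the diagonal; up to powers of \<open>-\<beta>\<close> and \<open>u\<^sub>i\<close> their quotient is the product of the
  inverse hook lengths.

  All denominators are nonzero because rational functions over an ordered field form an ordered
  field in which \<open>\<beta>\<close> is positive; the argument works in any ordered field.
\<close>

subsection \<open>Determinants\<close>

lemma det_mat_eq:
  "det (mat n n (\<lambda>(i, j). f i j)) = (\<Sum>p | p permutes {0..<n}. signof p * (\<Prod>i = 0..<n. f i (p i)))"
proof -
  have "(\<Prod>i = 0..<n. mat n n (\<lambda>(i, j). f i j) $$ (i, p i)) = (\<Prod>i = 0..<n. f i (p i))"
    if "p permutes {0..<n}" for p
    using permutes_in_image[OF that] by (intro prod.cong) auto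
  then show ?thesis
    by (simp add: det_def)
qed

lemma det_mat_cong:
  assumes "\<And>i j. i < n \<Longrightarrow> j < n \<Longrightarrow> f i j = g i j"
  shows "det (mat n n (\<lambda>(i, j). f i j)) = det (mat n n (\<lambda>(i, j). g i j))"
  using assms by (intro arg_cong[where f = det] eq_matI) auto

lemma det_mat_scale:
  fixes f :: "nat \<Rightarrow> nat \<Rightarrow> 'a::comm_ring_1"
  shows "det (mat n n (\<lambda>(i, j). r i * c j * f i j)) =
    (\<Prod>i<n. r i) * (\<Prod>j<n. c j) * det (mat n n (\<lambda>(i, j). f i j))"
proof -
  have "(\<Prod>i = 0..<n. r i * c (p i) * f i (p i)) =
      (\<Prod>i<n. r i) * (\<Prod>j<n. c j) * (\<Prod>i = 0..<n. f i (p i))" if "p permutes {0..<n}" for p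
    using prod.permute[OF that, of c] by (simp add: prod.distrib o_def lessThan_atLeast0)
  then show ?thesis
    by (simp add: det_mat_eq sum_distrib_left mult_ac)
qed

text \<open>Multilinearity in the rows, by distributing the product in each Leibniz term;
  \<open>S\<close> is the set of rows where \<open>g\<close> is chosen.\<close>

lemma det_mat_add:
  fixes f g :: "nat \<Rightarrow> nat \<Rightarrow> 'a::comm_ring_1"
  shows "det (mat n n (\<lambda>(i, j). f i j + g i j)) =
    (\<Sum>S\<in>Pow {..<n}. det (mat n n (\<lambda>(i, j). if i \<in> S then g i j else f i j)))"
proof -
  have "(\<Prod>i = 0..<n. f i (p i) + g i (p i)) =
      (\<Sum>S\<in>Pow {..<n}. \<Prod>i = 0..<n. if i \<in> S then g i (p i) else f i (p i))" for p
  proof -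
    have "(\<Prod>i = 0..<n. f i (p i) + g i (p i)) = (\<Prod>i<n. g i (p i) + f i (p i))"
      by (simp add: add.commute lessThan_atLeast0)
    also have "\<dots> = (\<Sum>S\<in>Pow {..<n}. (\<Prod>i\<in>S. g i (p i)) * (\<Prod>i\<in>{..<n} - S. f i (p i)))"
      by (rule prod_add) simp
    also have "\<dots> = (\<Sum>S\<in>Pow {..<n}. \<Prod>i = 0..<n. if i \<in> S then g i (p i) else f i (p i))"
    proof (rule sum.cong[OF refl])
      fix S assume "S \<in> Pow {..<n}"
      then have "{..<n} \<inter> {x. x \<in> S} = S" "{..<n} \<inter> - {x. x \<in> S} = {..<n} - S"
        by auto
      then show "(\<Prod>i\<in>S. g i (p i)) * (\<Prod>i\<in>{..<n} - S. f i (p i)) =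
          (\<Prod>i = 0..<n. if i \<in> S then g i (p i) else f i (p i))"
        by (simp add: prod.If_cases flip: lessThan_atLeast0)
    qed
    finally show ?thesis .
  qed
  then show ?thesis
    unfolding det_mat_eq by (simp add: sum_distrib_left) (rule sum.swap)
qed

lemma det_mat_zero_row:
  assumes "k < n" "\<And>j. j < n \<Longrightarrow> f k j = 0"
  shows "det (mat n n (\<lambda>(i, j). f i j)) = 0"
  unfolding det_mat_eq
proof (intro sum.neutral ballI)
  fix p assume "p \<in> {p. p permutes {0..<n}}"
  then have "f k (p k) = 0"
    using assms permutes_in_image[of p "{0..<n}" k] by auto
  then have "(\<Prod>i = 0..<n. f i (p i)) = 0"
    using assms(1) by (intro prod_zero) auto
  then show "signof p * (\<Prod>i = 0..<n. f i (p i)) = 0"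
    by simp
qed

text \<open>A permutation cannot map the \<open>q + 1\<close> indices up to \<open>q\<close> into
  the \<open>q\<close> indices below \<open>q\<close>, so every Leibniz term meets the zero
  block.\<close>

lemma det_mat_zero_block:
  assumes "q < n" "\<And>i j. i \<le> q \<Longrightarrow> q \<le> j \<Longrightarrow> j < n \<Longrightarrow> f i j = 0"
  shows "det (mat n n (\<lambda>(i, j). f i j)) = 0"
  unfolding det_mat_eq
proof (intro sum.neutral ballI)
  fix p assume "p \<in> {p. p permutes {0..<n}}"
  then have p: "p permutes {0..<n}" by simp
  have "\<not> p ` {..q} \<subseteq> {..<q}"
  proof
    assume "p ` {..q} \<subseteq> {..<q}"
    then have "card {..q} \<le> card {..<q}"
      using p by (intro card_inj_on_le[where f = p]) (auto intro: inj_on_subset[OF permutes_inj])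
    then show False by simp
  qed
  then obtain i where i: "i \<le> q" "q \<le> p i" by force
  then have "f i (p i) = 0"
    using assms permutes_in_image[OF p, of i] by auto
  then have "(\<Prod>i = 0..<n. f i (p i)) = 0"
    using assms(1) i by (intro prod_zero) auto
  then show "signof p * (\<Prod>i = 0..<n. f i (p i)) = 0"
    by simp
qed

lemma det_mat_add_row:
  fixes f :: "nat \<Rightarrow> nat \<Rightarrow> 'a::comm_ring_1"
  assumes "k < n" "l < n" "k \<noteq> l"
  shows "det (mat n n (\<lambda>(i, j). if i = k then f i j + a * f l j else f i j)) =
    det (mat n n (\<lambda>(i, j). f i j))"
proof -
  have "mat n n (\<lambda>(i, j). if i = k then f i j + a * f l j else f i j) =
      addrow a k l (mat n n (\<lambda>(i, j). f i j))"
    using assms by (intro eq_matI) auto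
  then show ?thesis
    using det_addrow[OF assms(2,3), of "mat n n (\<lambda>(i, j). f i j)" a] by simp
qed

lemma det_mat_lower_triangular:
  fixes f :: "nat \<Rightarrow> nat \<Rightarrow> 'a::comm_ring_1"
  assumes "\<And>i j. i < j \<Longrightarrow> j < n \<Longrightarrow> f i j = 0"
  shows "det (mat n n (\<lambda>(i, j). f i j)) = (\<Prod>i<n. f i i)"
proof -
  have "diag_mat (mat n n (\<lambda>(i, j). f i j)) = map (\<lambda>i. f i i) [0..<n]"
    by (auto simp: diag_mat_def)
  then show ?thesis
    using assms
    by (subst det_lower_triangular[of n])
       (auto simp: lessThan_atLeast0 simp flip: prod.distinct_set_conv_list)
qed

text \<open>Rows are modified in the order of decreasing rank, so that the row added to a row is
  still in its original state.\<close>

lemma det_mat_add_ranked_rows: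
  fixes f g :: "nat \<Rightarrow> nat \<Rightarrow> 'a::comm_ring_1" and rank :: "nat \<Rightarrow> nat"
  assumes B: "B \<subseteq> {..<n}" and inj: "inj_on rank B"
    and s: "\<And>i. i \<in> B \<Longrightarrow> s i < n \<and> rank (s i) < rank i"
    and g: "\<And>i j. i \<in> B \<Longrightarrow> j < n \<Longrightarrow> g i j = f i j + a i * f (s i) j"
  shows "det (mat n n (\<lambda>(i, j). if i \<in> B then g i j else f i j)) = det (mat n n (\<lambda>(i, j). f i j))"
proof -
  \<comment> \<open>Only rows of rank at least \<open>t\<close> are modified; as \<open>rank\<close>
    is injective on \<open>B\<close>, \<open>M t\<close> and \<open>M (Suc t)\<close> differ in at
    most one row.\<close>
  define M where "M t = det (mat n n (\<lambda>(i, j). if i \<in> B \<and> t \<le> rank i then g i j else f i j))" for t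
  have step: "M t = M (Suc t)" for t
  proof (cases "t \<in> rank ` B")
    case False
    then have "i \<in> B \<and> t \<le> rank i \<longleftrightarrow> i \<in> B \<and> Suc t \<le> rank i" for i
      by (auto simp: Suc_le_eq order_le_less)
    then show ?thesis by (simp add: M_def)
  next
    case True
    then obtain k where k: "k \<in> B" "t = rank k" by auto
    define h where "h i j = (if i \<in> B \<and> Suc t \<le> rank i then g i j else f i j)" for i j
    have "t \<le> rank i \<longleftrightarrow> i = k \<or> Suc t \<le> rank i" if "i \<in> B" for i
      using inj_onD[OF inj _ that k(1)] k(2) by (auto simp: Suc_le_eq order_le_less)
    then have "M t = det (mat n n (\<lambda>(i, j). if i = k then h i j + a k * h (s k) j else h i j))"
      unfolding M_def using k g s[OF k(1)] by (intro det_mat_cong) (auto simp: h_def)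
    also have "\<dots> = det (mat n n (\<lambda>(i, j). h i j))"
      using k s[OF k(1)] B by (intro det_mat_add_row) auto
    finally show ?thesis by (simp add: h_def M_def)
  qed
  have M: "M 0 = M t" for t
    by (induction t) (use step in auto)
  have "finite B"
    using B finite_subset by blast
  then obtain t where t: "rank i < t" if "i \<in> B" for i
    using finite_nat_bounded[of "rank ` B"] by auto
  have "M t = det (mat n n (\<lambda>(i, j). f i j))"
    unfolding M_def using t by (intro det_mat_cong) fastforce
  then show ?thesis using M[of t] by (simp add: M_def)
qed

section \<open>Falling factorials and their Vandermonde determinant\<close>

definition falling :: "'a::comm_ring_1 \<Rightarrow> nat \<Rightarrow> 'a" where
  "falling x k = (\<Prod>t<k. x - of_nat t)"

lemma falling_0 [simp]: "falling x 0 = 1"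
  by (simp add: falling_def)

lemma falling_Suc: "falling x (Suc k) = falling x k * (x - of_nat k)"
  by (simp add: falling_def)

lemma falling_of_nat_eq_0: "m < k \<Longrightarrow> falling (of_nat m) k = 0"
  unfolding falling_def by (rule prod_zero) auto

lemma falling_of_nat_self: "falling (of_nat m) m = of_nat (fact m)"
proof -
  have "(\<Prod>t<m. of_nat m - of_nat t) = (of_nat (\<Prod>t<m. m - t) :: 'a)"
    by simp
  also have "(\<Prod>t<m. m - t) = fact m"
    unfolding fact_prod_rev by (simp add: lessThan_atLeast0)
  finally show ?thesis by (simp add: falling_def)
qed

text \<open>As for ordinary powers: row operations clear the last column except for its final entry
  1, and after expansion along it each column \<open>j\<close> has the factor
  \<open>x j - x n\<close>.\<close>

lemma det_falling_vandermonde: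
  fixes x :: "nat \<Rightarrow> 'a::comm_ring_1"
  shows "det (mat n n (\<lambda>(i, j). falling (x j) (n - Suc i))) = (\<Prod>j<n. \<Prod>i<j. x i - x j)"
proof (induction n)
  case 0
  then show ?case by simp
next
  case (Suc n)
  define f where "f i j = falling (x j) (n - i)" for i j
  define g where "g i j = (x j - x n) * falling (x j) (n - Suc i)" for i j
  define A where "A = mat (Suc n) (Suc n) (\<lambda>(i, j). if i \<in> {..<n} then g i j else f i j)"
  have A: "A \<in> carrier_mat (Suc n) (Suc n)"
    by (simp add: A_def)
  have g: "g i j = f i j + (of_nat (n - Suc i) - x n) * f (Suc i) j" if "i < n" for i j
  proof -
    have "n - i = Suc (n - Suc i)" using that by simp
    then have "f i j = falling (x j) (n - Suc i) * (x j - of_nat (n - Suc i))"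
      unfolding f_def by (simp only: falling_Suc)
    then show ?thesis unfolding g_def f_def by (simp add: algebra_simps)
  qed
  have "det (mat (Suc n) (Suc n) (\<lambda>(i, j). f i j)) = det A"
    unfolding A_def using g
    by (intro det_mat_add_ranked_rows[where s = Suc and rank = "\<lambda>i. n - i", symmetric])
       (auto simp: inj_on_def)
  also have "\<dots> = (\<Sum>i<Suc n. A $$ (i, n) * cofactor A i n)"
    by (rule laplace_expansion_column[OF A]) simp
  also have "\<dots> = cofactor A n n"
    by (simp add: A_def g_def f_def)
  also have "\<dots> = det (mat n n (\<lambda>(i, j). 1 * (x j - x n) * falling (x j) (n - Suc i)))"
    unfolding cofactor_def A_def mat_delete_def
    by simp (intro arg_cong[where f = det] eq_matI; auto simp: g_def)
  also have "\<dots> = (\<Prod>j<n. x j - x n) * (\<Prod>j<n. \<Prod>i<j. x i - x j)"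
    unfolding det_mat_scale Suc.IH by simp
  finally show ?case by (simp add: f_def mult.commute)
qed

subsection \<open>The Chevalley rule\<close>

locale partition_rows =
  fixes lam :: "nat list" and d :: nat
  assumes partition: "is_partition lam" and length_le: "length lam \<le> d"
begin

text \<open>Row indices are 0-based from here on, whereas \<^const>\<open>part\<close> and \<^const>\<open>cells\<close> count from 1.
  A shape \<open>mu\<close> is a function on row indices; its values at indices \<open>\<ge> d\<close> are irrelevant.\<close>

definition rowlen :: "nat \<Rightarrow> nat" where
  "rowlen i = part lam (Suc i)"

text \<open>A beta-set of \<open>lam\<close> with \<open>d\<close> elements; for
  \<open>d = length lam\<close> these are the hook lengths in the first column.\<close>

definition shifted :: "nat \<Rightarrow> nat" where
  "shifted i = rowlen i + d - Suc i"

lemma rowlen_antimono: "i \<le> j \<Longrightarrow> rowlen j \<le> rowlen i"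
  using partition sorted_wrt_nth_less[of "(\<ge>)" lam i j]
  by (cases "i = j") (auto simp: rowlen_def part_def is_partition_def)

lemma rowlen_eq_0: "d \<le> i \<Longrightarrow> rowlen i = 0"
  using length_le by (simp add: rowlen_def part_def)

lemma shifted_less: "i < j \<Longrightarrow> j < d \<Longrightarrow> shifted j < shifted i"
  using rowlen_antimono[of i j] by (simp add: shifted_def)

lemma shifted_antimono: "i \<le> j \<Longrightarrow> j < d \<Longrightarrow> shifted j \<le> shifted i"
  using shifted_less[of i j] by (cases "i = j") auto

definition subpartition :: "(nat \<Rightarrow> nat) \<Rightarrow> bool" where
  "subpartition mu \<longleftrightarrow> (\<forall>i j. i \<le> j \<longrightarrow> j < d \<longrightarrow> mu j \<le> mu i) \<and> (\<forall>i<d. mu i \<le> rowlen i)"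

definition add_cells :: "nat set \<Rightarrow> (nat \<Rightarrow> nat) \<Rightarrow> nat \<Rightarrow> nat" where
  "add_cells S mu i = (if i \<in> S then Suc (mu i) else mu i)"

text \<open>Rows as long as the row above: a cell added there would leave the shape or lie below
  another new cell.\<close>

definition repeated :: "(nat \<Rightarrow> nat) \<Rightarrow> nat set" where
  "repeated mu = {i. 0 < i \<and> i < d \<and> mu i = mu (i - 1)}"

text \<open>Rook strips that can be added to \<open>mu\<close> inside \<open>lam\<close>, encoded by
  their rows; the empty strip is included.\<close>

definition strips :: "(nat \<Rightarrow> nat) \<Rightarrow> nat set set" where
  "strips mu = {S. S \<subseteq> {..<d} \<and> S \<inter> repeated mu = {} \<and> (\<forall>i\<in>S. mu i < rowlen i)}"

lemma finite_strips: "finite (strips mu)"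
  by (rule finite_subset[of _ "Pow {..<d}"]) (auto simp: strips_def)

lemma add_cells_antimono:
  assumes mu: "\<And>i j. i \<le> j \<Longrightarrow> j < d \<Longrightarrow> mu j \<le> mu i"
    and S: "S \<inter> repeated mu = {}" and ij: "i \<le> j" "j < d"
  shows "add_cells S mu j \<le> add_cells S mu i"
proof (cases "i = j \<or> j \<notin> S")
  case True
  then show ?thesis using mu[OF ij] by (auto simp: add_cells_def)
next
  case False
  then have "mu j \<noteq> mu (j - 1)" using S ij by (auto simp: repeated_def)
  moreover have "mu j \<le> mu (j - 1)" "mu (j - 1) \<le> mu i" using False ij by (auto intro: mu)
  ultimately show ?thesis by (auto simp: add_cells_def)
qed

lemma subpartition_add_cells:
  assumes "subpartition mu" "S \<in> strips mu"
  shows "subpartition (add_cells S mu)"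
proof -
  have "add_cells S mu j \<le> add_cells S mu i" if "i \<le> j" "j < d" for i j
    by (rule add_cells_antimono) (use assms that in \<open>auto simp: subpartition_def strips_def\<close>)
  then show ?thesis
    using assms by (auto simp: subpartition_def strips_def add_cells_def Suc_le_eq)
qed

end

section \<open>Determinants attached to shapes over an ordered field\<close>

locale weighted_partition_rows = partition_rows +
  fixes b :: "'a::linordered_field"
  assumes b_pos: "b > 0"
begin

text \<open>With 0-based rows, \<open>d - i\<close> stands for the \<open>d - i + 1\<close> of the
  theorem; \<open>u (rowlen i) i\<close> is the \<open>u\<^sub>i\<close> of the overview.\<close>

definition u :: "nat \<Rightarrow> nat \<Rightarrow> 'a" where
  "u m i = 1 + b * of_nat (m + d - i)"

lemma u_pos: "u m i > 0"
  unfolding u_def by (intro add_pos_nonneg mult_nonneg_nonneg) (use b_pos in auto)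

lemma u_nonzero [simp]: "u m i \<noteq> 0"
  using u_pos[of m i] by simp

lemma u_less: "m < m' \<Longrightarrow> i < d \<Longrightarrow> u m i < u m' i"
  using b_pos by (auto simp: u_def)

definition entry :: "nat \<Rightarrow> nat \<Rightarrow> nat \<Rightarrow> 'a" where
  "entry m i j = falling (of_nat (shifted j)) (m + d - Suc i) * (- b) ^ (m + d - Suc i)
     * inverse (u (rowlen j) j) ^ m"

definition D :: "(nat \<Rightarrow> nat) \<Rightarrow> 'a" where
  "D mu = det (mat d d (\<lambda>(i, j). entry (mu i) i j))"

definition ratio :: "(nat \<Rightarrow> nat) \<Rightarrow> 'a" where
  "ratio mu = (\<Prod>i<d. u (mu i) i / u (rowlen i) i)"

text \<open>Raising \<open>m\<close> multiplies the entry by \<open>- b * (l - k) / u'\<close>,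
  where \<open>l = shifted j\<close>, \<open>k = m + d - Suc i\<close> and
  \<open>u' = 1 + b * (l + 1)\<close>. Since \<open>u' - b * (l - k) = 1 + b * (k + 1)\<close>, the
  sum factors.\<close>

lemma entry_add_entry_Suc:
  assumes "i < d" "j < d"
  shows "entry m i j + entry (Suc m) i j = u m i * inverse (u (rowlen j) j) * entry m i j"
proof -
  define k where "k = m + d - Suc i"
  have k: "Suc m + d - Suc i = Suc k" "m + d - i = Suc k"
    using assms by (auto simp: k_def)
  have j: "rowlen j + d - j = Suc (shifted j)"
    using assms by (auto simp: shifted_def)
  have "entry (Suc m) i j =
      - b * (of_nat (shifted j) - of_nat k) * inverse (u (rowlen j) j) * entry m i j"
    unfolding entry_def k by (simp add: falling_Suc k_def)
  moreover have "1 + - b * (of_nat (shifted j) - of_nat k) * inverse (u (rowlen j) j) =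
      u m i * inverse (u (rowlen j) j)"
  proof -
    have "u (rowlen j) j - b * (of_nat (shifted j) - of_nat k) = u m i"
      unfolding u_def j k by (simp add: algebra_simps)
    then show ?thesis by (simp add: field_simps)
  qed
  ultimately show ?thesis by (metis distrib_right mult_1)
qed

text \<open>The index \<open>m + d - Suc i\<close> does not change when \<open>m\<close> and
  \<open>i\<close> both grow by one, so only the power of \<open>u\<close> differs.\<close>

lemma entry_Suc_row:
  assumes "0 < i"
  shows "entry (Suc m) i j = inverse (u (rowlen j) j) * entry m (i - 1) j"
  using assms by (simp add: entry_def)

text \<open>The numerators of \<open>ratio mu\<close> scale the rows and the denominators the
  columns. Each row then is the sum of itself and its raised version, and multilinearity expands the
  determinant.\<close>

lemma ratio_mult_D:
  "ratio mu * D mu = (\<Sum>S | S \<subseteq> {..<d} \<and> S \<inter> repeated mu = {}. D (add_cells S mu))"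
proof -
  define f where "f i j = entry (mu i) i j" for i j
  \<comment> \<open>The zero in repeated rows makes every choice \<open>S\<close> that meets
    \<open>repeated mu\<close> vanish.\<close>
  define g where "g i j = (if i \<in> repeated mu then 0 else entry (Suc (mu i)) i j)" for i j
  define h where "h i j = entry (mu i) i j + entry (Suc (mu i)) i j" for i j
  have h: "h i j = u (mu i) i * inverse (u (rowlen j) j) * f i j" if "i < d" "j < d" for i j
    using entry_add_entry_Suc[OF that] by (simp add: h_def f_def)
  have "ratio mu * D mu = det (mat d d (\<lambda>(i, j). u (mu i) i * inverse (u (rowlen j) j) * f i j))"
    by (simp add: det_mat_scale ratio_def D_def f_def divide_inverse prod.distrib)
  also have "\<dots> = det (mat d d (\<lambda>(i, j). h i j))"
    by (intro det_mat_cong) (simp add: h)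
  \<comment> \<open>In a repeated row the raised summand is a multiple of row \<open>i - 1\<close>
    of \<open>h\<close>, hence removable; working from the bottom up keeps that row intact.\<close>
  also have "\<dots> = det (mat d d (\<lambda>(i, j). if i \<in> repeated mu then f i j else h i j))"
  proof (rule det_mat_add_ranked_rows[where rank = "\<lambda>i. i" and s = "\<lambda>i. i - 1", symmetric])
    fix i j assume i: "i \<in> repeated mu" and j: "j < d"
    then have "0 < i" "i < d" "mu i = mu (i - 1)" by (auto simp: repeated_def)
    then have "h i j = f i j + inverse (u (rowlen j) j) * f (i - 1) j"
      using entry_Suc_row[of i "mu i" j] by (simp add: h_def f_def)
    moreover have "h (i - 1) j = u (mu (i - 1)) (i - 1) * inverse (u (rowlen j) j) * f (i - 1) j"
      using \<open>i < d\<close> j by (intro h) auto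
    ultimately show "f i j = h i j + - inverse (u (mu (i - 1)) (i - 1)) * h (i - 1) j"
      by simp
  qed (auto simp: repeated_def)
  also have "\<dots> = det (mat d d (\<lambda>(i, j). f i j + g i j))"
    by (intro det_mat_cong) (simp add: f_def g_def h_def)
  also have "\<dots> = (\<Sum>S\<in>Pow {..<d}. det (mat d d (\<lambda>(i, j). if i \<in> S then g i j else f i j)))"
    by (rule det_mat_add)
  also have "\<dots> = (\<Sum>S | S \<subseteq> {..<d} \<and> S \<inter> repeated mu = {}.
      det (mat d d (\<lambda>(i, j). if i \<in> S then g i j else f i j)))"
  proof (rule sum.mono_neutral_right)
    show "\<forall>S\<in>Pow {..<d} - {S. S \<subseteq> {..<d} \<and> S \<inter> repeated mu = {}}.
        det (mat d d (\<lambda>(i, j). if i \<in> S then g i j else f i j)) = 0"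
    proof
      fix S assume "S \<in> Pow {..<d} - {S. S \<subseteq> {..<d} \<and> S \<inter> repeated mu = {}}"
      then obtain i where "i \<in> S" "i < d" "i \<in> repeated mu" by auto
      then show "det (mat d d (\<lambda>(i, j). if i \<in> S then g i j else f i j)) = 0"
        by (intro det_mat_zero_row[of i]) (auto simp: g_def)
    qed
  qed auto
  also have "\<dots> = (\<Sum>S | S \<subseteq> {..<d} \<and> S \<inter> repeated mu = {}. D (add_cells S mu))"
    unfolding D_def
    by (intro sum.cong refl det_mat_cong) (auto simp: f_def g_def add_cells_def)
  finally show ?thesis .
qed

lemma entry_eq_0: "shifted j < m + d - Suc i \<Longrightarrow> entry m i j = 0"
  by (simp add: entry_def falling_of_nat_eq_0)

text \<open>If \<open>mu\<close> sticks out of \<open>lam\<close> in row \<open>q\<close>, the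
  falling factorials vanish in rows up to \<open>q\<close> and columns from \<open>q\<close> on, a
  block too large for a nonzero determinant.\<close>

lemma D_eq_0:
  assumes mu: "\<And>i j. i \<le> j \<Longrightarrow> j < d \<Longrightarrow> mu j \<le> mu i" and q: "q < d" "rowlen q < mu q"
  shows "D mu = 0"
  unfolding D_def
proof (rule det_mat_zero_block[OF q(1)])
  fix i j assume ij: "i \<le> q" "q \<le> j" "j < d"
  have "shifted j \<le> shifted q" using shifted_antimono ij by simp
  also have "\<dots> < mu q + d - Suc q" using q by (simp add: shifted_def)
  also have "\<dots> \<le> mu i + d - Suc i" using mu[OF ij(1)] q ij by simp
  finally show "entry (mu i) i j = 0" by (rule entry_eq_0)
qed

lemma ratio_mult_D_strips:
  assumes "subpartition mu"
  shows "ratio mu * D mu = (\<Sum>S\<in>strips mu. D (add_cells S mu))"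
  unfolding ratio_mult_D
proof (rule sum.mono_neutral_right)
  show "\<forall>S\<in>{S. S \<subseteq> {..<d} \<and> S \<inter> repeated mu = {}} - strips mu. D (add_cells S mu) = 0"
  proof
    fix S assume S: "S \<in> {S. S \<subseteq> {..<d} \<and> S \<inter> repeated mu = {}} - strips mu"
    then obtain q where "q \<in> S" "q < d" "rowlen q \<le> mu q"
      by (auto simp: strips_def not_less)
    moreover have "add_cells S mu j \<le> add_cells S mu i" if "i \<le> j" "j < d" for i j
      by (rule add_cells_antimono) (use assms S that in \<open>auto simp: subpartition_def\<close>)
    ultimately show "D (add_cells S mu) = 0"
      by (intro D_eq_0[of _ q]) (auto simp: add_cells_def)
  qed
qed (auto simp: strips_def)

text \<open>Above the diagonal the falling factorial has more factors than its argument
  \<open>shifted j\<close>, so the matrix is triangular.\<close>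

lemma D_full: "D rowlen = (\<Prod>i<d. of_nat (fact (shifted i)) * (- b) ^ shifted i
  * inverse (u (rowlen i) i) ^ rowlen i)"
proof -
  have "D rowlen = (\<Prod>i<d. entry (rowlen i) i i)"
    unfolding D_def
  proof (rule det_mat_lower_triangular)
    fix i j assume "i < j" "j < d"
    then show "entry (rowlen i) i j = 0"
      using shifted_less[of i j] by (intro entry_eq_0) (simp add: shifted_def)
  qed
  then show ?thesis
    by (simp add: entry_def falling_of_nat_self flip: shifted_def)
qed

lemma D_full_nonzero: "D rowlen \<noteq> 0"
  using b_pos by (simp add: D_full)

lemma D_empty: "D (\<lambda>i. 0) =
  (\<Prod>i<d. (- b) ^ (d - Suc i)) * (\<Prod>j<d. \<Prod>i<j. of_nat (shifted i) - of_nat (shifted j))"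
proof -
  have "D (\<lambda>i. 0) = det (mat d d (\<lambda>(i, j).
      (- b) ^ (d - Suc i) * 1 * falling (of_nat (shifted j)) (d - Suc i)))"
    by (simp add: D_def entry_def mult.commute)
  then show ?thesis
    unfolding det_mat_scale det_falling_vandermonde by simp
qed

text \<open>Gives the nonvanishing of the denominators \<open>ratio mu - 1\<close> in the
  weights.\<close>

lemma ratio_less_1:
  assumes "\<And>i. i < d \<Longrightarrow> mu i \<le> rowlen i" "q < d" "mu q < rowlen q"
  shows "ratio mu < 1"
proof -
  have "ratio mu = u (mu q) q / u (rowlen q) q * (\<Prod>i\<in>{..<d} - {q}. u (mu i) i / u (rowlen i) i)"
    using assms by (simp add: ratio_def prod.remove)
  also have "\<dots> \<le> u (mu q) q / u (rowlen q) q * 1"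
  proof (intro mult_left_mono prod_le_1 conjI)
    fix i assume "i \<in> {..<d} - {q}"
    then have "u (mu i) i \<le> u (rowlen i) i"
      using assms(1)[of i] u_less[of "mu i" "rowlen i" i] by (auto simp: order_le_less)
    then show "u (mu i) i / u (rowlen i) i \<le> 1"
      using u_pos by simp
  qed (use u_pos in \<open>auto intro: less_imp_le\<close>)
  also have "\<dots> < 1"
    using u_less[OF assms(3,2)] u_pos by simp
  finally show ?thesis .
qed

end

subsection \<open>Skew increasing tableaux\<close>

context partition_rows
begin

definition skew :: "(nat \<Rightarrow> nat) \<Rightarrow> (nat \<times> nat) set" where
  "skew mu = {(Suc i, j) | i j. mu i < j \<and> j \<le> rowlen i}"

lemma skew_Suc [simp]: "(Suc i, j) \<in> skew mu \<longleftrightarrow> mu i < j \<and> j \<le> rowlen i"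
  by (simp add: skew_def)

lemma skew_0 [simp]: "(0, j) \<notin> skew mu"
  by (simp add: skew_def)

lemma skewE:
  assumes "(i, j) \<in> skew mu"
  obtains i' where "i = Suc i'" "i' < d" "mu i' < j" "j \<le> rowlen i'"
  using assms rowlen_eq_0 by (cases i) (auto, metis le_0_eq not_le not_less_zero)

lemma cells_eq_skew: "cells lam = skew (\<lambda>i. 0)"
  by (auto simp: cells_def skew_def rowlen_def part_def Suc_le_eq gr0_conv_Suc)

lemma finite_skew: "finite (skew mu)"
proof (rule finite_subset)
  show "skew mu \<subseteq> {..d} \<times> {..rowlen 0}"
    using rowlen_antimono[of 0] by (auto elim!: skewE intro: order_trans)
qed simp

definition tableaux :: "(nat \<Rightarrow> nat) \<Rightarrow> (nat \<times> nat \<Rightarrow> nat) set" where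
  "tableaux mu = {T. (\<forall>c. c \<notin> skew mu \<longrightarrow> T c = 0)
     \<and> (\<forall>i j j'. (i, j) \<in> skew mu \<longrightarrow> (i, j') \<in> skew mu \<longrightarrow> j < j' \<longrightarrow> T (i, j) < T (i, j'))
     \<and> (\<forall>i i' j. (i, j) \<in> skew mu \<longrightarrow> (i', j) \<in> skew mu \<longrightarrow> i < i' \<longrightarrow> T (i, j) < T (i', j))
     \<and> (\<exists>m. T ` skew mu = {1..m})}"

lemma SIT_eq_tableaux: "SIT lam = tableaux (\<lambda>i. 0)"
  by (simp add: SIT_def tableaux_def cells_eq_skew)

lemma tableaux_pos: "T \<in> tableaux mu \<Longrightarrow> c \<in> skew mu \<Longrightarrow> 1 \<le> T c"
  by (auto simp: tableaux_def)

lemma tableaux_outside: "T \<in> tableaux mu \<Longrightarrow> c \<notin> skew mu \<Longrightarrow> T c = 0"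
  unfolding tableaux_def by blast

lemma finite_tableaux: "finite (tableaux mu)"
proof (rule finite_subset)
  show "tableaux mu \<subseteq> {T. \<forall>c. (c \<in> skew mu \<longrightarrow> T c \<in> {..card (skew mu)}) \<and> (c \<notin> skew mu \<longrightarrow> T c = 0)}"
  proof
    fix T assume T: "T \<in> tableaux mu"
    then obtain m where m: "T ` skew mu = {1..m}" by (auto simp: tableaux_def)
    then have "m \<le> card (skew mu)" using card_image_le[OF finite_skew, of T mu] by simp
    then have "T c \<le> card (skew mu)" if "c \<in> skew mu" for c
      using m imageI[OF that, of T] by simp
    then show "T \<in> {T. \<forall>c. (c \<in> skew mu \<longrightarrow> T c \<in> {..card (skew mu)}) \<and> (c \<notin> skew mu \<longrightarrow> T c = 0)}"
      using tableaux_outside[OF T] by simp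
  qed
  show "finite {T. \<forall>c. (c \<in> skew mu \<longrightarrow> T c \<in> {..card (skew mu)}) \<and> (c \<notin> skew mu \<longrightarrow> T c = 0)}"
    by (rule finite_set_of_finite_funs) (auto simp: finite_skew)
qed

text \<open>In a tableau an entry 1 can only stand in the first skew cell of its row, so row indices
  record all of them.\<close>

definition ones :: "(nat \<Rightarrow> nat) \<Rightarrow> (nat \<times> nat \<Rightarrow> nat) \<Rightarrow> nat set" where
  "ones mu T = {i. T (Suc i, Suc (mu i)) = 1}"

text \<open>Cells of \<open>skew mu\<close> missing from the smaller shape have the default value 0
  under \<open>T\<close>, so incrementing turns exactly them into entries 1.\<close>

definition lift :: "(nat \<Rightarrow> nat) \<Rightarrow> (nat \<times> nat \<Rightarrow> nat) \<Rightarrow> nat \<times> nat \<Rightarrow> nat" where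
  "lift mu T c = (if c \<in> skew mu then Suc (T c) else 0)"

lemma skew_add_cells:
  "(Suc i, j) \<in> skew (add_cells S mu) \<longleftrightarrow> (Suc i, j) \<in> skew mu \<and> \<not> (i \<in> S \<and> j = Suc (mu i))"
  by (auto simp: add_cells_def)

lemma skew_add_cells_subset: "skew (add_cells S mu) \<subseteq> skew mu"
  by (auto elim!: skewE simp: add_cells_def split: if_splits)

lemma ones_iff:
  assumes T: "T \<in> tableaux mu" and c: "(Suc i, j) \<in> skew mu"
  shows "T (Suc i, j) = 1 \<longleftrightarrow> i \<in> ones mu T \<and> j = Suc (mu i)"
proof
  assume 1: "T (Suc i, j) = 1"
  have "j = Suc (mu i)"
  proof (rule ccontr)
    assume "j \<noteq> Suc (mu i)"
    then have j: "Suc (mu i) < j" "(Suc i, Suc (mu i)) \<in> skew mu" using c by auto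
    then have "T (Suc i, Suc (mu i)) < T (Suc i, j)" using T c unfolding tableaux_def by blast
    then show False using tableaux_pos[OF T j(2)] 1 by simp
  qed
  then show "i \<in> ones mu T \<and> j = Suc (mu i)" using 1 by (simp add: ones_def)
qed (simp add: ones_def)

lemma ones_in_skew: "T \<in> tableaux mu \<Longrightarrow> i \<in> ones mu T \<Longrightarrow> (Suc i, Suc (mu i)) \<in> skew mu"
  using tableaux_outside by (fastforce simp: ones_def)

text \<open>In a repeated row the cell above the first skew cell is a skew cell too, and its entry
  would have to be below 1.\<close>

lemma ones_in_strips:
  assumes mu: "subpartition mu" and T: "T \<in> tableaux mu"
  shows "ones mu T \<in> strips mu"
proof -
  have "i < d \<and> mu i < rowlen i \<and> i \<notin> repeated mu" if i: "i \<in> ones mu T" for i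
  proof (intro conjI notI)
    have c: "(Suc i, Suc (mu i)) \<in> skew mu" by (rule ones_in_skew[OF T i])
    then show "i < d" by (rule skewE) simp
    show "mu i < rowlen i" using c by simp
    assume "i \<in> repeated mu"
    then have i': "0 < i" "mu i = mu (i - 1)" by (auto simp: repeated_def)
    then have c': "(i, Suc (mu i)) \<in> skew mu"
      using c rowlen_antimono[of "i - 1" i] skew_Suc[of "i - 1" "Suc (mu i)" mu] by simp
    then have "T (i, Suc (mu i)) < T (Suc i, Suc (mu i))"
      using T c unfolding tableaux_def by blast
    then show False using tableaux_pos[OF T c'] i by (simp add: ones_def)
  qed
  then show ?thesis by (auto simp: strips_def)
qed

lemma ones_nonempty:
  assumes T: "T \<in> tableaux mu" and ne: "skew mu \<noteq> {}"
  shows "ones mu T \<noteq> {}"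
proof -
  obtain m where "T ` skew mu = {1..m}" using T by (auto simp: tableaux_def)
  then have "1 \<in> T ` skew mu" using ne by auto
  then obtain i j where c: "(i, j) \<in> skew mu" "T (i, j) = 1" by auto
  then obtain i' where "i = Suc i'" by (auto elim: skewE)
  then show ?thesis using ones_iff[OF T, of i' j] c by auto
qed

lemma skew_ones:
  assumes T: "T \<in> tableaux mu"
  shows "c \<in> skew (add_cells (ones mu T) mu) \<longleftrightarrow> c \<in> skew mu \<and> T c \<noteq> 1"
proof (cases c)
  case (Pair i j)
  then show ?thesis
    using ones_iff[OF T] skew_add_cells[of _ j "ones mu T" mu] by (cases i) (auto simp del: skew_Suc)
qed

lemma lower_in_tableaux:
  assumes T: "T \<in> tableaux mu"
  shows "(\<lambda>c. T c - 1) \<in> tableaux (add_cells (ones mu T) mu)"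
proof -
  let ?X = "skew (add_cells (ones mu T) mu)"
  obtain m where m: "T ` skew mu = {1..m}" using T by (auto simp: tableaux_def)
  \<comment> \<open>Truncated subtraction sends the removed entries 1 and the outside value 0 alike
    to 0.\<close>
  have "T c - 1 = 0" if "c \<notin> ?X" for c
    using that skew_ones[OF T, of c] tableaux_outside[OF T, of c] by auto
  moreover have "T c - 1 < T c' - 1" if "c \<in> ?X" "T c < T c'" for c c'
    using that skew_ones[OF T, of c] tableaux_pos[OF T, of c] by auto
  moreover have "(\<lambda>c. T c - 1) ` ?X = {1..m - 1}"
  proof -
    have "T ` ?X = T ` skew mu - {1}"
      using skew_ones[OF T] by auto
    then have "(\<lambda>c. T c - 1) ` ?X = (\<lambda>x. x - 1) ` {2..m}"
      unfolding m by (subst image_image[symmetric, of "\<lambda>x. x - 1"]) (auto intro!: arg_cong[where f = "image _"])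
    also have "\<dots> = {1..m - 1}"
    proof
      show "{1..m - 1} \<subseteq> (\<lambda>x. x - 1) ` {2..m}"
      proof
        fix x assume "x \<in> {1..m - 1}"
        then show "x \<in> (\<lambda>x. x - 1) ` {2..m}" by (intro image_eqI[of _ _ "Suc x"]) auto
      qed
    qed auto
    finally show ?thesis .
  qed
  moreover have "c \<in> skew mu" if "c \<in> ?X" for c
    using that skew_ones[OF T] by auto
  ultimately show ?thesis
    using T unfolding tableaux_def by auto
qed

lemma lift_in_tableaux:
  assumes mu: "subpartition mu" and S: "S \<in> strips mu" "S \<noteq> {}"
    and T: "T \<in> tableaux (add_cells S mu)"
  shows "lift mu T \<in> tableaux mu" and "ones mu (lift mu T) = S"
    and "lift mu T ` skew mu = {1..Suc (card (T ` skew (add_cells S mu)))}"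
proof -
  let ?X = "skew (add_cells S mu)"
  have S': "(Suc i, Suc (mu i)) \<in> skew mu" "(Suc i, Suc (mu i)) \<notin> ?X" if "i \<in> S" for i
    using S that by (auto simp: strips_def add_cells_def)
  have new: "\<exists>i'. i = Suc i' \<and> i' \<in> S \<and> j = Suc (mu i')"
    if "(i, j) \<in> skew mu" "(i, j) \<notin> ?X" for i j
    using that by (cases i) (auto simp: skew_add_cells simp del: skew_Suc)
  have less: "T c < T c'" if "c' \<in> ?X" "c \<notin> ?X" for c c'
    using tableaux_pos[OF T that(1)] tableaux_outside[OF T that(2)] by simp
  obtain m where m: "T ` ?X = {1..m}" using T by (auto simp: tableaux_def)
  have rows: "T (i, j) < T (i, j')" if c: "(i, j) \<in> skew mu" "(i, j') \<in> skew mu" "j < j'" for i j j'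
  proof -
    \<comment> \<open>A new cell is the leftmost skew cell of its row, so the right cell of the pair
      is old.\<close>
    have "(i, j') \<in> ?X" using new[OF c(2)] c by fastforce
    moreover have "T (i, j) < T (i, j')" if "(i, j) \<in> ?X" "(i, j') \<in> ?X"
      using T that \<open>j < j'\<close> unfolding tableaux_def by blast
    ultimately show ?thesis using less by blast
  qed
  have columns: "T (i, j) < T (i', j)" if c: "(i, j) \<in> skew mu" "(i', j) \<in> skew mu" "i < i'" for i i' j
  proof -
    \<comment> \<open>The lower cell is old: above a new cell in row \<open>r\<close>, every row of
      \<open>mu\<close> is longer than \<open>mu r\<close> and covers column
      \<open>j\<close>.\<close>
    have "(i', j) \<in> ?X"
    proof (rule ccontr)
      assume "(i', j) \<notin> ?X"
      then obtain r where r: "i' = Suc r" "r \<in> S" "j = Suc (mu r)" using new[OF c(2)] by auto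
      obtain q where q: "i = Suc q" "mu q < j" using c(1) by (auto elim: skewE)
      have "q < r" "r < d" "r \<notin> repeated mu" using S r q c(3) by (auto simp: strips_def)
      then have "mu r < mu (r - 1)" "mu (r - 1) \<le> mu q"
        using mu unfolding subpartition_def repeated_def
        by (force simp: order_less_le, simp)
      then show False using q r by simp
    qed
    moreover have "T (i, j) < T (i', j)" if "(i, j) \<in> ?X" "(i', j) \<in> ?X"
      using T that \<open>i < i'\<close> unfolding tableaux_def by blast
    ultimately show ?thesis using less by blast
  qed
  have image: "lift mu T ` skew mu = {1..Suc m}"
  proof -
    have "lift mu T ` skew mu = Suc ` T ` skew mu"
      by (auto simp: lift_def image_image)
    also have "T ` skew mu = T ` ?X \<union> T ` (skew mu - ?X)"
      using skew_add_cells_subset[of S mu] by auto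
    also have "T ` (skew mu - ?X) = {0}"
    proof -
      obtain i where "i \<in> S" using S(2) by auto
      then have "skew mu - ?X \<noteq> {}" using S'[of i] by blast
      moreover have "T c = 0" if "c \<in> skew mu - ?X" for c
        using that tableaux_outside[OF T] by blast
      ultimately show ?thesis by force
    qed
    also have "Suc ` (T ` ?X \<union> {0}) = {1..Suc m}"
      unfolding m by (auto simp: image_iff Bex_def gr0_conv_Suc)
    finally show ?thesis .
  qed
  then show "lift mu T ` skew mu = {1..Suc (card (T ` ?X))}"
    by (simp add: m)
  show "lift mu T \<in> tableaux mu"
    using rows columns image unfolding tableaux_def by (auto simp: lift_def)
  have "i \<in> ones mu (lift mu T) \<longleftrightarrow> i \<in> S" for i
  proof
    assume "i \<in> S"
    then show "i \<in> ones mu (lift mu T)"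
      using S' tableaux_outside[OF T] by (simp add: ones_def lift_def)
  next
    assume "i \<in> ones mu (lift mu T)"
    then have i: "(Suc i, Suc (mu i)) \<in> skew mu" "T (Suc i, Suc (mu i)) = 0"
      unfolding ones_def lift_def by (auto split: if_splits)
    then have "(Suc i, Suc (mu i)) \<notin> ?X" by (auto dest: tableaux_pos[OF T] simp del: skew_Suc)
    then show "i \<in> S" using new[OF i(1)] by auto
  qed
  then show "ones mu (lift mu T) = S" by auto
qed

text \<open>The recursion for tableaux: split off the cells with entry 1, a nonempty strip, and
  decrease all other entries.\<close>

lemma bij_betw_lift:
  assumes mu: "subpartition mu" and ne: "skew mu \<noteq> {}"
  shows "bij_betw (\<lambda>(S, T). lift mu T) (SIGMA S:strips mu - {{}}. tableaux (add_cells S mu)) (tableaux mu)"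
proof (rule bij_betw_byWitness[where f' = "\<lambda>T. (ones mu T, \<lambda>c. T c - 1)"])
  show "\<forall>a\<in>SIGMA S:strips mu - {{}}. tableaux (add_cells S mu).
      (\<lambda>T. (ones mu T, \<lambda>c. T c - 1)) ((\<lambda>(S, T). lift mu T) a) = a"
  proof
    fix a assume "a \<in> (SIGMA S:strips mu - {{}}. tableaux (add_cells S mu))"
    then obtain S T where a: "a = (S, T)" "S \<in> strips mu" "S \<noteq> {}" "T \<in> tableaux (add_cells S mu)"
      by auto
    have "lift mu T c - 1 = T c" for c
      using tableaux_outside[OF a(4), of c] skew_add_cells_subset[of S mu] by (auto simp: lift_def)
    then show "(\<lambda>T. (ones mu T, \<lambda>c. T c - 1)) ((\<lambda>(S, T). lift mu T) a) = a"
      using lift_in_tableaux(2)[OF mu a(2-4)] a(1) by auto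
  qed
  show "\<forall>T\<in>tableaux mu. (\<lambda>(S, T). lift mu T) (ones mu T, \<lambda>c. T c - 1) = T"
    using tableaux_pos tableaux_outside by (fastforce simp: lift_def)
  show "(\<lambda>(S, T). lift mu T) ` (SIGMA S:strips mu - {{}}. tableaux (add_cells S mu)) \<subseteq> tableaux mu"
    using lift_in_tableaux(1)[OF mu] by auto
  show "(\<lambda>T. (ones mu T, \<lambda>c. T c - 1)) ` tableaux mu
      \<subseteq> (SIGMA S:strips mu - {{}}. tableaux (add_cells S mu))"
    using ones_in_strips[OF mu] ones_nonempty[OF _ ne] lower_in_tableaux by auto
qed

lemma nu_lift_1:
  assumes "\<And>i. i < d \<Longrightarrow> mu i \<le> rowlen i" and "i < d"
  shows "nu lam (lift mu T) 1 (Suc i) = mu i"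
proof -
  have "{j. (Suc i, j) \<in> cells lam \<and> lift mu T (Suc i, j) < 1} = {1..mu i}"
    using assms(1)[OF assms(2)] by (auto simp: cells_eq_skew lift_def)
  then show ?thesis by (simp add: nu_def)
qed

lemma nu_lift_Suc:
  assumes "1 \<le> k" and "T \<in> tableaux (add_cells S mu)"
  shows "nu lam (lift mu T) (Suc k) i = nu lam T k i"
proof -
  have "T c = 0" if "c \<notin> skew mu" for c
    using that tableaux_outside[OF assms(2)] skew_add_cells_subset by blast
  then have "lift mu T c < Suc k \<longleftrightarrow> T c < k" for c
    using assms(1) by (simp add: lift_def)
  then show ?thesis by (simp add: nu_def)
qed

end

section \<open>Weighted sums over skew tableaux\<close>

context weighted_partition_rows
begin

text \<open>\<open>nu\<close> counts in all of \<open>lam\<close>: for \<open>mu\<close> inside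
  \<open>lam\<close>, the cells of \<open>mu\<close> have value 0 and so belong to every shape
  \<open>T\<^sub><\<^sub>k\<close>.\<close>

definition weight :: "(nat \<Rightarrow> nat) \<Rightarrow> (nat \<times> nat \<Rightarrow> nat) \<Rightarrow> 'a" where
  "weight mu T = (\<Prod>k = 1..card (T ` skew mu). inverse (ratio (\<lambda>i. nu lam T k (Suc i)) - 1))"

lemma ratio_cong: "(\<And>i. i < d \<Longrightarrow> mu i = mu' i) \<Longrightarrow> ratio mu = ratio mu'"
  by (simp add: ratio_def)

lemma D_cong: "(\<And>i. i < d \<Longrightarrow> mu i = mu' i) \<Longrightarrow> D mu = D mu'"
  unfolding D_def by (intro det_mat_cong) simp

lemma weight_lift:
  assumes mu: "subpartition mu" and S: "S \<in> strips mu" "S \<noteq> {}"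
    and T: "T \<in> tableaux (add_cells S mu)"
  shows "weight mu (lift mu T) = inverse (ratio mu - 1) * weight (add_cells S mu) T"
proof -
  define m where "m = card (T ` skew (add_cells S mu))"
  define F where "F k = inverse (ratio (\<lambda>i. nu lam (lift mu T) k (Suc i)) - 1)" for k
  have "weight mu (lift mu T) = (\<Prod>k = 1..Suc m. F k)"
    unfolding weight_def F_def lift_in_tableaux(3)[OF assms] by (simp add: m_def)
  also have "\<dots> = F 1 * (\<Prod>k = 1..m. F (Suc k))"
    by (subst prod.atLeast_Suc_atMost, simp, simp only: prod.atLeast_Suc_atMost_Suc_shift o_def)
  also have "F 1 = inverse (ratio mu - 1)"
    unfolding F_def using mu
    by (subst ratio_cong[of _ mu]) (auto intro!: nu_lift_1 simp: subpartition_def simp del: One_nat_def)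
  also have "(\<Prod>k = 1..m. F (Suc k)) = weight (add_cells S mu) T"
    unfolding F_def weight_def m_def using nu_lift_Suc[OF _ T] by (intro prod.cong) simp_all
  finally show ?thesis .
qed

text \<open>Both sides satisfy the same recursion over nonempty strips; the induction is on the
  number of cells of \<open>lam\<close> outside \<open>mu\<close>.\<close>

lemma sum_weight:
  assumes "subpartition mu"
  shows "(\<Sum>T\<in>tableaux mu. weight mu T) = D mu / D rowlen"
  using assms
proof (induction "\<Sum>i<d. rowlen i - mu i" arbitrary: mu rule: less_induct)
  case less
  note mu = less.prems
  have le: "mu i \<le> rowlen i" if "i < d" for i
    using mu that by (simp add: subpartition_def)
  show ?case
  proof (cases "skew mu = {}")
    case True
    have "tableaux mu = {\<lambda>c. 0}"
      by (auto simp: tableaux_def True)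
    moreover have "mu i = rowlen i" if "i < d" for i
    proof (rule ccontr)
      assume "mu i \<noteq> rowlen i"
      then have "(Suc i, rowlen i) \<in> skew mu" using le[OF that] by simp
      then show False using True by blast
    qed
    then have "D mu = D rowlen" by (rule D_cong)
    ultimately show ?thesis
      using D_full_nonzero by (simp add: weight_def True)
  next
    case False
    then obtain q j where "(Suc q, j) \<in> skew mu" "q < d"
      by (metis all_not_in_conv skewE surj_pair)
    then have ratio: "ratio mu < 1"
      using le by (intro ratio_less_1[of _ q]) auto
    have IH: "(\<Sum>T\<in>tableaux (add_cells S mu). weight (add_cells S mu) T) = D (add_cells S mu) / D rowlen"
      if S: "S \<in> strips mu - {{}}" for S
    proof (rule less.hyps)
      obtain i where i: "i \<in> S" "i < d" "mu i < rowlen i" using S by (auto simp: strips_def)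
      show "(\<Sum>i<d. rowlen i - add_cells S mu i) < (\<Sum>i<d. rowlen i - mu i)"
        by (rule sum_strict_mono_ex1) (use i in \<open>auto simp: add_cells_def intro!: bexI[of _ i]\<close>)
      show "subpartition (add_cells S mu)" using S by (intro subpartition_add_cells[OF mu]) auto
    qed
    have "(\<Sum>T\<in>tableaux mu. weight mu T) =
        (\<Sum>(S, T)\<in>(SIGMA S:strips mu - {{}}. tableaux (add_cells S mu)). weight mu (lift mu T))"
      using sum.reindex_bij_betw[OF bij_betw_lift[OF mu False], of "weight mu"]
      by (simp add: case_prod_beta)
    also have "\<dots> = (\<Sum>S\<in>strips mu - {{}}. \<Sum>T\<in>tableaux (add_cells S mu). weight mu (lift mu T))"
      by (intro sum.Sigma[symmetric]) (auto simp: finite_strips finite_tableaux)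
    also have "\<dots> = (\<Sum>S\<in>strips mu - {{}}. inverse (ratio mu - 1) * (D (add_cells S mu) / D rowlen))"
    proof (rule sum.cong[OF refl])
      fix S assume S: "S \<in> strips mu - {{}}"
      then have "(\<Sum>T\<in>tableaux (add_cells S mu). weight mu (lift mu T)) =
          (\<Sum>T\<in>tableaux (add_cells S mu). inverse (ratio mu - 1) * weight (add_cells S mu) T)"
        using weight_lift[OF mu] by (intro sum.cong) auto
      then show "(\<Sum>T\<in>tableaux (add_cells S mu). weight mu (lift mu T)) =
          inverse (ratio mu - 1) * (D (add_cells S mu) / D rowlen)"
        using IH[OF S] by (simp flip: sum_distrib_left)
    qed
    also have "\<dots> = inverse (ratio mu - 1) * (\<Sum>S\<in>strips mu - {{}}. D (add_cells S mu)) / D rowlen"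
      by (simp add: sum_distrib_left sum_divide_distrib)
    \<comment> \<open>The empty strip contributes \<open>D mu\<close>; moving it to the other side
      of the Chevalley rule produces the \<open>- 1\<close> of the weight.\<close>
    also have "(\<Sum>S\<in>strips mu - {{}}. D (add_cells S mu)) = (ratio mu - 1) * D mu"
    proof -
      have "{} \<in> strips mu" by (simp add: strips_def)
      moreover have "add_cells {} mu = mu" by (simp add: add_cells_def fun_eq_iff)
      ultimately show ?thesis
        using ratio_mult_D_strips[OF mu] finite_strips[of mu]
        by (simp add: sum_diff1 algebra_simps)
    qed
    finally show ?thesis using ratio by simp
  qed
qed

end

subsection \<open>Hook lengths\<close>

context partition_rows
begin

text \<open>Row lengths decrease, so the rows reaching column \<open>j\<close> form an initial
  segment, whose size is \<open>conj_part lam j\<close>.\<close>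

lemma less_conj_part_iff:
  assumes "1 \<le> j"
  shows "r < conj_part lam j \<longleftrightarrow> j \<le> rowlen r"
proof -
  define n where "n = (LEAST r. rowlen r < j)"
  have "rowlen d < j" using assms rowlen_eq_0[of d] by simp
  then have n: "rowlen n < j" unfolding n_def by (rule LeastI)
  have iff: "j \<le> rowlen r \<longleftrightarrow> r < n" for r
  proof
    show "r < n" if "j \<le> rowlen r"
      using n that rowlen_antimono[of n r] by linarith
    show "j \<le> rowlen r" if "r < n"
      using that not_less_Least[of r "\<lambda>r. rowlen r < j"] by (simp add: n_def)
  qed
  have "{i. (i, j) \<in> cells lam} = Suc ` {..<n}"
  proof
    show "{i. (i, j) \<in> cells lam} \<subseteq> Suc ` {..<n}"
      by (auto simp: cells_eq_skew iff elim!: skewE)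
    show "Suc ` {..<n} \<subseteq> {i. (i, j) \<in> cells lam}"
      using assms by (auto simp: cells_eq_skew iff)
  qed
  then show ?thesis
    by (simp add: conj_part_def card_image iff)
qed

lemma conj_part_le: "1 \<le> j \<Longrightarrow> conj_part lam j \<le> d"
  using less_conj_part_iff[of j d] rowlen_eq_0[of d] by simp

lemma conj_part_antimono: "1 \<le> j \<Longrightarrow> j \<le> j' \<Longrightarrow> conj_part lam j' \<le> conj_part lam j"
  using less_conj_part_iff[of j "conj_part lam j"] less_conj_part_iff[of j' "conj_part lam j"]
  by (auto simp: not_less[symmetric])

text \<open>The two families of factors are disjoint and together exhaust \<open>{1..shifted i}\<close>.\<close>

lemma prod_hook_row:
  assumes i: "i < d"
  shows "(\<Prod>j = 1..rowlen i. hook lam (Suc i) j) * (\<Prod>r\<in>{i<..<d}. shifted i - shifted r) =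
    fact (shifted i)"
proof -
  let ?h = "hook lam (Suc i)" and ?g = "\<lambda>r. shifted i - shifted r"
  have h: "i < conj_part lam j" "?h j = rowlen i - j + (conj_part lam j - Suc i) + 1"
    if "j \<in> {1..rowlen i}" for j
    using that less_conj_part_iff[of j i] by (auto simp: hook_def rowlen_def)
  have "?h j' < ?h j" if "j \<in> {1..rowlen i}" "j' \<in> {1..rowlen i}" "j < j'" for j j'
    using h[OF that(1)] h[OF that(2)] conj_part_antimono[of j j'] that by auto
  then have inj_h: "inj_on ?h {1..rowlen i}"
    by (intro linorder_inj_onI') (metis less_irrefl)
  have "?g r < ?g r'" if "r \<in> {i<..<d}" "r' \<in> {i<..<d}" "r < r'" for r r'
    using that shifted_less[of r r'] shifted_less[of i r] by auto
  then have inj_g: "inj_on ?g {i<..<d}"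
    by (intro linorder_inj_onI') (metis less_irrefl)
  \<comment> \<open>The hook length exceeds the difference if column \<open>j\<close> reaches row
    \<open>r\<close>, and is smaller otherwise.\<close>
  have disjoint: "?h ` {1..rowlen i} \<inter> ?g ` {i<..<d} = {}"
  proof -
    have "?h j \<noteq> ?g r" if j: "j \<in> {1..rowlen i}" and r: "r \<in> {i<..<d}" for j r
    proof -
      have "rowlen r \<le> rowlen i" using r rowlen_antimono[of i r] by simp
      then show ?thesis
        using h[OF j] j r less_conj_part_iff[of j r] by (cases "j \<le> rowlen r") (auto simp: shifted_def)
    qed
    then show ?thesis by blast
  qed
  \<comment> \<open>By counting: the two families have \<open>rowlen i\<close> and
    \<open>d - Suc i\<close> members, which add up to \<open>shifted i\<close>.\<close>
  have "?h ` {1..rowlen i} \<union> ?g ` {i<..<d} = {1..shifted i}"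
  proof (rule card_subset_eq)
    have "?h j \<in> {1..shifted i}" if "j \<in> {1..rowlen i}" for j
      using h[OF that] conj_part_le[of j] that i by (auto simp: shifted_def)
    moreover have "?g r \<in> {1..shifted i}" if "r \<in> {i<..<d}" for r
      using that shifted_less[of i r] by auto
    ultimately show "?h ` {1..rowlen i} \<union> ?g ` {i<..<d} \<subseteq> {1..shifted i}" by blast
    show "card (?h ` {1..rowlen i} \<union> ?g ` {i<..<d}) = card {1..shifted i}"
      unfolding card_Un_disjoint[OF finite_imageI[OF finite_atLeastAtMost]
          finite_imageI[OF finite_greaterThanLessThan] disjoint]
        card_image[OF inj_h] card_image[OF inj_g]
      using i by (simp add: shifted_def)
  qed simp
  then have "fact (shifted i) = prod id (?h ` {1..rowlen i} \<union> ?g ` {i<..<d})"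
    by (simp add: fact_prod)
  also have "\<dots> = prod id (?h ` {1..rowlen i}) * prod id (?g ` {i<..<d})"
    using disjoint by (intro prod.union_disjoint) auto
  finally show ?thesis
    using inj_h inj_g by (simp add: prod.reindex)
qed

lemma prod_cells: "(\<Prod>(i, j)\<in>cells lam. f i j) = (\<Prod>i<d. \<Prod>j = 1..rowlen i. f (Suc i) j)"
proof -
  have "bij_betw (\<lambda>(i, j). (Suc i, j)) (SIGMA i:{..<d}. {1..rowlen i}) (cells lam)"
    unfolding cells_eq_skew
    by (rule bij_betw_byWitness[where f' = "\<lambda>(i, j). (i - 1, j)"])
       (auto simp: Suc_le_eq elim!: skewE)
  then show ?thesis
    using prod.reindex_bij_betw[of "\<lambda>(i, j). (Suc i, j)" _ "cells lam" "\<lambda>(i, j). f i j"]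
    by (simp add: prod.Sigma case_prod_beta)
qed

lemma sum_list_eq: "sum_list lam = (\<Sum>i<d. rowlen i)"
proof -
  have "sum_list lam = (\<Sum>i<length lam. rowlen i)"
    by (simp add: sum_list_sum_nth lessThan_atLeast0 rowlen_def part_def)
  also have "\<dots> = (\<Sum>i<d. rowlen i)"
    using length_le by (intro sum.mono_neutral_left) (auto simp: rowlen_def part_def)
  finally show ?thesis .
qed

end

section \<open>The quotient of the two determinants\<close>

context weighted_partition_rows
begin

lemma D_empty_over_D_full:
  "D (\<lambda>i. 0) / D rowlen = inverse ((- b) ^ sum_list lam)
    * (\<Prod>i<d. u (rowlen i) i ^ rowlen i) * (\<Prod>(i, j)\<in>cells lam. inverse (of_nat (hook lam i j)))"
proof -
  define V :: 'a where "V = (\<Prod>i<d. \<Prod>r\<in>{i<..<d}. of_nat (shifted i - shifted r))"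
  define H :: 'a where "H = (\<Prod>(i, j)\<in>cells lam. of_nat (hook lam i j))"
  define P :: 'a where "P = (\<Prod>i<d. (- b) ^ (d - Suc i))"
  define U where "U = (\<Prod>i<d. u (rowlen i) i ^ rowlen i)"
  have "of_nat (shifted i - shifted r) \<noteq> (0 :: 'a)" if "i < r" "r < d" for i r
    using shifted_less[OF that] by simp
  then have V0: "V \<noteq> 0" by (auto simp: V_def)
  have P0: "P \<noteq> 0" using b_pos by (simp add: P_def)
  have "(\<Prod>j<d. \<Prod>i<j. of_nat (shifted i) - of_nat (shifted j)) =
      (\<Prod>j<d. \<Prod>i\<in>{i\<in>{..<d}. i < j}. of_nat (shifted i - shifted j) :: 'a)"
    by (intro prod.cong) (auto simp: shifted_antimono)
  also have "\<dots> = (\<Prod>i<d. \<Prod>j\<in>{j\<in>{..<d}. i < j}. of_nat (shifted i - shifted j))"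
    by (rule prod.swap_restrict) auto
  also have "\<dots> = V"
    unfolding V_def by (intro prod.cong) auto
  finally have D0: "D (\<lambda>i. 0) = P * V"
    by (simp add: D_empty P_def)
  \<comment> \<open>The product of the row identities: the Vandermonde factor \<open>V\<close> turns
    factorials into hook lengths and cancels against the numerator.\<close>
  have HV: "(\<Prod>i<d. of_nat (fact (shifted i))) = H * V"
    unfolding H_def V_def prod_cells prod.distrib[symmetric]
    by (intro prod.cong refl) (simp flip: of_nat_prod of_nat_mult prod_hook_row)
  have "(\<Prod>i<d. (- b) ^ shifted i) = (\<Prod>i<d. (- b) ^ rowlen i * (- b) ^ (d - Suc i))"
    by (intro prod.cong refl) (simp add: shifted_def flip: power_add)
  also have "\<dots> = (- b) ^ sum_list lam * P"
    by (simp add: prod.distrib P_def sum_list_eq power_sum)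
  finally have D1: "D rowlen = H * V * ((- b) ^ sum_list lam * P) * inverse U"
    by (simp add: D_full prod.distrib HV[simplified of_nat_fact] U_def power_inverse flip: prod_inversef)
  have "(\<Prod>(i, j)\<in>cells lam. inverse (of_nat (hook lam i j))) = inverse H"
    unfolding H_def by (simp add: case_prod_beta flip: prod_inversef)
  then show ?thesis
    unfolding D0 D1 U_def[symmetric] using V0 P0 by (simp add: field_simps)
qed

end

text \<open>Polynomials are ordered by the sign of the leading coefficient, and the order extends to
  fractions.\<close>

lemma beta_pos: "beta > 0"
proof -
  have "0 < [:0, 1 :: rat:]" by (simp add: less_poly_def pos_poly_pCons)
  then show ?thesis by (simp add: beta_def zero_less_Fract_iff)
qed

theorem theorem1p1:
  fixes d :: nat and lam :: "nat list"
  assumes "d \<ge> 1" and "is_partition lam" and "length lam \<le> d"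
  shows "(\<Sum>T\<in>SIT lam. \<Prod>k=1..mT lam T.
            inverse ((\<Prod>i=1..d. (1 + beta * of_nat (nu lam T k i + d + 1 - i))
                                  / (1 + beta * of_nat (part lam i + d + 1 - i))) - 1))
       = inverse ((- beta) ^ sum_list lam)
         * (\<Prod>i=1..length lam. (1 + beta * of_nat (part lam i + d + 1 - i)) ^ part lam i)
         * (\<Prod>(i, j)\<in>cells lam. inverse (of_nat (hook lam i j)))"
proof -
  interpret weighted_partition_rows lam d beta
    by unfold_locales (use assms beta_pos in auto)
  have ratio: "(\<Prod>i=1..d. (1 + beta * of_nat (nu lam T k i + d + 1 - i))
      / (1 + beta * of_nat (part lam i + d + 1 - i))) = ratio (\<lambda>i. nu lam T k (Suc i))" for T k
    unfolding One_nat_def prod.atLeast1_atMost_eq by (simp add: ratio_def u_def rowlen_def)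
  have "(\<Sum>T\<in>SIT lam. \<Prod>k=1..mT lam T.
      inverse ((\<Prod>i=1..d. (1 + beta * of_nat (nu lam T k i + d + 1 - i))
        / (1 + beta * of_nat (part lam i + d + 1 - i))) - 1)) =
      (\<Sum>T\<in>tableaux (\<lambda>i. 0). weight (\<lambda>i. 0) T)"
    unfolding ratio SIT_eq_tableaux weight_def mT_def cells_eq_skew ..
  also have "\<dots> = D (\<lambda>i. 0) / D rowlen"
    by (rule sum_weight) (simp add: subpartition_def)
  also have "\<dots> = inverse ((- beta) ^ sum_list lam) * (\<Prod>i<d. u (rowlen i) i ^ rowlen i)
      * (\<Prod>(i, j)\<in>cells lam. inverse (of_nat (hook lam i j)))"
    by (rule D_empty_over_D_full)
  \<comment> \<open>Rows beyond the length of \<open>lam\<close> have exponent 0.\<close>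
  also have "(\<Prod>i<d. u (rowlen i) i ^ rowlen i) = (\<Prod>i<length lam. u (rowlen i) i ^ rowlen i)"
    using assms(3) by (intro prod.mono_neutral_right) (auto simp: rowlen_def part_def)
  also have "\<dots> = (\<Prod>i=1..length lam. (1 + beta * of_nat (part lam i + d + 1 - i)) ^ part lam i)"
    unfolding One_nat_def prod.atLeast1_atMost_eq by (simp add: u_def rowlen_def)
  finally show ?thesis .
qed

end
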